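(* Consider the algorithm Slow-DiskANN, which on input a finite metric space $(P,\mathsf{d})$ and $\alpha\ge 1$ starts from $E=\emptyset$ and, for each $s\in P$: sets $U\leftarrow P\setminus\{s\}$ sorted by increasing $\mathsf{d}(s,\cdot)$ (ties in the sort may be broken arbitrarily); then for each $u\in U$ in this order (skipping elements already removed), adds the edge $(s,u)$ to $E$ and removes from $U$ every $t$ with $\mathsf{d}(u,t)<\mathsf{d}(s,t)/\alpha$; finally it outputs $G=(P,E)$. In the worst case (over inputs), Slow-DiskANN incurs an approximation factor of $\Omega(n/\log n)$ to the sparsest $\alpha$-navigable graph, where $n=|P|$, under both the maximum out-degree objective and the total number of edges objective.
   Context: For $\alpha\ge 1$, a directed graph $G=(P,E)$ on a finite metric space $(P,\mathsf{d})$ is $\alpha$-navigable if for every $s,t\in P$ with $\mathsf{d}(s,t)>0$ there is $u\in P$ with $(s,u)\in E$ and $\mathsf{d}(u,t)<\mathsf{d}(s,t)/\alpha$. An $\alpha$-navigable graph $G$ is a $c$-approximation to the sparsest $\alpha$-navigable graph under the maximum out-degree objective if its maximum out-degree is at most $c$ times the maximum out-degree of every $\alpha$-navigable graph on $P$; under the total-edges (average-degree) objective if $|E|$ is at most $c$ times the number of edges of every $\alpha$-navigable graph on $P$. *)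

theory Defs
  imports "HOL-Analysis.Analysis"
begin

definition navigable :: "'a set \<Rightarrow> ('a \<Rightarrow> 'a \<Rightarrow> real) \<Rightarrow> real \<Rightarrow> ('a \<times> 'a) set \<Rightarrow> bool" where
  "navigable P d \<alpha> E \<longleftrightarrow> E \<subseteq> P \<times> P \<and>
     (\<forall>s\<in>P. \<forall>t\<in>P. d s t > 0 \<longrightarrow> (\<exists>u\<in>P. (s, u) \<in> E \<and> d u t < d s t / \<alpha>))"

definition max_out_degree :: "'a set \<Rightarrow> ('a \<times> 'a) set \<Rightarrow> nat" where
  "max_out_degree P E = Max ((\<lambda>s. card (E `` {s})) ` P)"

definition approx_max_degree ::
    "'a set \<Rightarrow> ('a \<Rightarrow> 'a \<Rightarrow> real) \<Rightarrow> real \<Rightarrow> real \<Rightarrow> ('a \<times> 'a) set \<Rightarrow> bool" where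
  "approx_max_degree P d \<alpha> c E \<longleftrightarrow> navigable P d \<alpha> E \<and>
     (\<forall>F. navigable P d \<alpha> F \<longrightarrow> real (max_out_degree P E) \<le> c * real (max_out_degree P F))"

definition approx_total_edges ::
    "'a set \<Rightarrow> ('a \<Rightarrow> 'a \<Rightarrow> real) \<Rightarrow> real \<Rightarrow> real \<Rightarrow> ('a \<times> 'a) set \<Rightarrow> bool" where
  "approx_total_edges P d \<alpha> c E \<longleftrightarrow> navigable P d \<alpha> E \<and>
     (\<forall>F. navigable P d \<alpha> F \<longrightarrow> real (card E) \<le> c * real (card F))"

text \<open>
  The inner loop of Slow-DiskANN for a source \<open>s\<close>: the list is what remains of the sorted \<open>U\<close>,
  and the result is the list of heads of the edges added at \<open>s\<close>. Elements preceding \<open>u\<close> have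
  already been selected or removed, so filtering only the tail loses nothing.
\<close>

function select :: "('a \<Rightarrow> 'a \<Rightarrow> real) \<Rightarrow> real \<Rightarrow> 'a \<Rightarrow> 'a list \<Rightarrow> 'a list" where
  "select d \<alpha> s [] = []"
| "select d \<alpha> s (u # us) = u # select d \<alpha> s (filter (\<lambda>t. \<not> d u t < d s t / \<alpha>) us)"
  by pat_completeness auto
termination
  by (relation "Wellfounded.measure (\<lambda>(d, \<alpha>, s, us). length us)") (auto simp: less_Suc_eq_le)

definition scan_order :: "'a set \<Rightarrow> ('a \<Rightarrow> 'a \<Rightarrow> real) \<Rightarrow> 'a \<Rightarrow> 'a list \<Rightarrow> bool" where
  "scan_order P d s us \<longleftrightarrow>
     distinct us \<and> set us = P - {s} \<and> sorted_wrt (\<lambda>u v. d s u \<le> d s v) us"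

text \<open>
  A relation rather than a function: \<open>E\<close> is an output if it arises from some way of breaking
  the ties in the sorting step, chosen independently for each source.
\<close>

definition slow_diskann ::
    "'a set \<Rightarrow> ('a \<Rightarrow> 'a \<Rightarrow> real) \<Rightarrow> real \<Rightarrow> ('a \<times> 'a) set \<Rightarrow> bool" where
  "slow_diskann P d \<alpha> E \<longleftrightarrow>
     (\<exists>ord. (\<forall>s\<in>P. scan_order P d s (ord s)) \<and> E = (SIGMA s:P. set (select d \<alpha> s (ord s))))"

lemma slow_diskann_exists:
  assumes "finite P"
  shows "\<exists>E. slow_diskann P d \<alpha> E"
proof -
  have "\<exists>us. scan_order P d s us" for s
  proof -
    obtain xs where "set xs = P - {s}" "distinct xs"
      using assms finite_distinct_list[of "P - {s}"] by auto
    then have "scan_order P d s (sort_key (d s) xs)"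
      using sorted_sort_key[of "d s" xs] by (simp add: scan_order_def sorted_map)
    then show ?thesis ..
  qed
  then obtain ord where "\<And>s. scan_order P d s (ord s)" by metis
  then show ?thesis unfolding slow_diskann_def by blast
qed

lemma select_subset: "set (select d \<alpha> s us) \<subseteq> set us"
  by (induction d \<alpha> s us rule: select.induct) auto

lemma select_covers:
  "t \<in> set us \<Longrightarrow> t \<in> set (select d \<alpha> s us) \<or> (\<exists>u\<in>set (select d \<alpha> s us). d u t < d s t / \<alpha>)"
  by (induction d \<alpha> s us rule: select.induct) auto

lemma slow_diskann_navigable:
  assumes "Metric_space P d" and "\<alpha> \<ge> 1" and "slow_diskann P d \<alpha> E"
  shows "navigable P d \<alpha> E"
proof -
  interpret Metric_space P d by fact
  obtain ord where ord: "\<And>s. s \<in> P \<Longrightarrow> scan_order P d s (ord s)"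
    and E: "E = (SIGMA s:P. set (select d \<alpha> s (ord s)))"
    using assms(3) unfolding slow_diskann_def by blast
  have sub: "set (select d \<alpha> s (ord s)) \<subseteq> P" if "s \<in> P" for s
    using select_subset[of d \<alpha> s "ord s"] ord[OF that] by (auto simp: scan_order_def)
  have "\<exists>u\<in>P. (s, u) \<in> E \<and> d u t < d s t / \<alpha>" if st: "s \<in> P" "t \<in> P" "d s t > 0" for s t
  proof -
    have "t \<in> set (ord s)" using ord[OF st(1)] st by (auto simp: scan_order_def)
    moreover have "d t t < d s t / \<alpha>" using st assms(2) by simp
    ultimately have "\<exists>u\<in>set (select d \<alpha> s (ord s)). d u t < d s t / \<alpha>"
      using select_covers[of t "ord s" d \<alpha> s] by blast
    then show ?thesis using sub[OF st(1)] st(1) by (auto simp: E)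
  qed
  then show ?thesis using sub by (auto simp: navigable_def E)
qed

end

theory Submission
  imports Defs
begin

text \<open>
  Take \<open>\<alpha> = 1\<close>, so that a greedy step only has to make some progress, however small. The points
  form three classes, each indexed along a line: sources \<open>a\<^sub>i\<close>, targets \<open>b\<^sub>i\<close> and hubs \<open>h\<^sub>i\<close>.
  Every distance between distinct points lies between \<open>4n\<close> and \<open>8n\<close>, which makes the triangle
  inequality automatic. All source-target and target-target distances are equal (\<open>6n\<close>), sources
  are closer than that to each other, and hubs are further away from the sources. Hence a source
  scans all targets before any hub, and nothing scanned so far removes a target: each of the
  linearly many sources gets an edge to each of the linearly many targets. However, the hubs are
  close to the targets, and walking along the line of hubs (or of sources) slowly decreases the
  distance to every point, so edges between points of nearby index already form a navigable graph
  of constant degree. The resulting factor is even linear in \<open>n\<close>.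
\<close>

text \<open>
  The points are the numbers below \<open>n\<close>; the index of \<open>x\<close> is \<open>x div 3\<close>, and its class is hub,
  source or target according to \<open>x mod 3 = 0, 1, 2\<close>.
\<close>

definition index_gap :: "nat \<Rightarrow> nat \<Rightarrow> real" where
  "index_gap x y = \<bar>real (x div 3) - real (y div 3)\<bar>"

text \<open>The residue sum encodes the pair of classes. The pair source-source is caught by the
  first branch, so sum \<open>2\<close> means hub-target, sum \<open>1\<close> means hub-source, and
  the last branch holds source-target and target-target. For points below \<open>n\<close> the gap
  is less than \<open>n\<close>, so the values of different branches do not overlap.\<close>

definition hub_dist :: "nat \<Rightarrow> nat \<Rightarrow> nat \<Rightarrow> real" where
  "hub_dist n x y =
     (if x = y then 0
      else if x mod 3 = y mod 3 \<and> x mod 3 \<noteq> 2 then 4 * real n + index_gap x y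
      else if x mod 3 + y mod 3 = 2 then 5 * real n + index_gap x y
      else if x mod 3 + y mod 3 = 1 then 7 * real n + index_gap x y
      else 6 * real n)"

text \<open>A difference of \<open>3\<close> is one index step inside a class; the bound also admits
  all pairs of equal index.\<close>

definition near_edges :: "nat \<Rightarrow> (nat \<times> nat) set" where
  "near_edges n = {(x, y). x < n \<and> y < n \<and> x \<le> y + 3 \<and> y \<le> x + 3}"

section \<open>The metric space\<close>

lemma index_gap_nonneg: "0 \<le> index_gap x y"
  by (simp add: index_gap_def)

lemma index_gap_less:
  assumes "x < n" "y < n"
  shows "index_gap x y < real n"
proof -
  have "x div 3 < n" "y div 3 < n" using assms by linarith+
  then show ?thesis unfolding index_gap_def by linarith
qed

lemma hub_dist_commute: "hub_dist n x y = hub_dist n y x"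
  by (auto simp: hub_dist_def index_gap_def abs_minus_commute add.commute)

lemma hub_dist_self [simp]: "hub_dist n x x = 0"
  by (simp add: hub_dist_def)

lemma hub_dist_bounds:
  assumes "x < n" "y < n" "x \<noteq> y"
  shows "4 * real n \<le> hub_dist n x y" "hub_dist n x y \<le> 8 * real n"
  using assms index_gap_nonneg[of x y] index_gap_less[of x n y] by (auto simp: hub_dist_def)

lemma Metric_space_hub_dist: "Metric_space {..<n} (hub_dist n)"
proof
  show nonneg: "0 \<le> hub_dist n x y" for x y
    using index_gap_nonneg[of x y] by (simp add: hub_dist_def)
  show "hub_dist n x y = hub_dist n y x" for x y
    by (rule hub_dist_commute)
  show "(hub_dist n x y = 0) = (x = y)" if "x \<in> {..<n}" "y \<in> {..<n}" for x y
    using that hub_dist_bounds(1)[of x n y] by (cases "x = y") auto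
  show "hub_dist n x z \<le> hub_dist n x y + hub_dist n y z"
    if "x \<in> {..<n}" "y \<in> {..<n}" "z \<in> {..<n}" for x y z
  proof (cases "x = y \<or> y = z \<or> x = z")
    case True
    then show ?thesis using nonneg[of x y] nonneg[of y x] by auto
  next
    case False
    then show ?thesis
      using that hub_dist_bounds(1)[of x n y] hub_dist_bounds(1)[of y n z]
        hub_dist_bounds(2)[of x n z] by simp
  qed
qed

section \<open>A sparse navigable graph\<close>

text \<open>From a hub to any point, and between sources, the distance is a constant plus the gap,
  so one index step towards \<open>t\<close> inside the class of \<open>s\<close> lowers it.\<close>

lemma hub_dist_step_along_line:
  assumes "s < n" "t < n" "s div 3 \<noteq> t div 3" and "s mod 3 = 0 \<or> s mod 3 = 1 \<and> t mod 3 = 1"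
  shows "\<exists>u<n. (s, u) \<in> near_edges n \<and> hub_dist n u t < hub_dist n s t"
proof -
  define k where "k = (if s div 3 < t div 3 then s div 3 + 1 else s div 3 - 1)"
  define u where "u = 3 * k + s mod 3"
  have div: "3 * (s div 3) + s mod 3 = s" "3 * (t div 3) + t mod 3 = t" by simp_all
  have "u < n \<and> s \<le> u + 3 \<and> u \<le> s + 3"
  proof (cases "s div 3 < t div 3")
    case True
    then have "u = s + 3" using div by (simp add: u_def k_def)
    \<comment> \<open>A forward step must stay below \<open>n\<close>: as the residue of
      \<open>s\<close> is at most that of \<open>t\<close>, it cannot overshoot
      \<open>t\<close>.\<close>
    moreover have "s mod 3 \<le> t mod 3" using assms(4) by auto
    then have "s + 3 \<le> t" using True div by linarith
    ultimately show ?thesis using assms(2) by simp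
  next
    case False
    then have "3 * k + 3 = 3 * (s div 3)" using assms(3) by (simp add: k_def)
    then have "u + 3 = s" using div(1) unfolding u_def by linarith
    then show ?thesis using assms(1) by simp
  qed
  then have u: "u < n" "(s, u) \<in> near_edges n" using assms(1) by (auto simp: near_edges_def)
  have umod: "u mod 3 = s mod 3" and "u div 3 = k" by (simp_all add: u_def)
  then have gap: "index_gap u t < index_gap s t"
    using assms(3) by (auto simp: index_gap_def k_def)
  have "hub_dist n u t < hub_dist n s t"
  proof (cases "u = t")
    case True
    moreover have "s \<noteq> t" using assms(3) by auto
    then have "0 < hub_dist n s t" using assms(1,2) hub_dist_bounds(1)[of s n t] by simp
    ultimately show ?thesis by simp
  next
    case False
    moreover have "s \<noteq> t" using assms(3) by auto
    moreover have "t mod 3 = 0 \<or> t mod 3 = 1 \<or> t mod 3 = 2" by presburger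
    ultimately show ?thesis using gap umod assms(4) by (auto simp: hub_dist_def)
  qed
  then show ?thesis using u by blast
qed

text \<open>Here the index is kept and the class changes: to the source if \<open>t\<close> is a
  source, otherwise to the hub. The leading multiple of \<open>n\<close> drops, and since the gap is
  below \<open>n\<close> this wins even where the old distance is \<open>6 * n\<close> without a
  gap.\<close>

lemma hub_dist_step_within_group:
  assumes "s < n" "t < n" "s div 3 \<noteq> t div 3" "s mod 3 \<noteq> 0" "\<not> (s mod 3 = 1 \<and> t mod 3 = 1)"
  shows "\<exists>u<n. (s, u) \<in> near_edges n \<and> hub_dist n u t < hub_dist n s t"
proof -
  define r where "r = (if t mod 3 = 1 then 1 else 0 :: nat)"
  define u where "u = 3 * (s div 3) + r"
  have "3 * (s div 3) + s mod 3 = s" "s mod 3 < 3" by simp_all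
  moreover have "r \<le> s mod 3" using assms(4) by (simp add: r_def)
  ultimately have "u \<le> s" "s \<le> u + 3" unfolding u_def by linarith+
  then have u: "u < n" "(s, u) \<in> near_edges n" using assms(1) by (auto simp: near_edges_def)
  have udiv: "u div 3 = s div 3" and umod: "u mod 3 = r" by (auto simp: u_def r_def)
  have "index_gap u t = index_gap s t" using udiv by (simp add: index_gap_def)
  moreover have "u \<noteq> t" "s \<noteq> t" using udiv assms(3) by auto
  moreover have "t mod 3 = 0 \<or> t mod 3 = 1 \<or> t mod 3 = 2" by presburger
  moreover have "s mod 3 = 1 \<or> s mod 3 = 2" using assms(4) by presburger
  moreover have "index_gap s t < real n" "0 \<le> index_gap s t"
    using index_gap_less assms index_gap_nonneg by auto
  ultimately have "hub_dist n u t < hub_dist n s t"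
    using umod assms(5) by (auto simp: hub_dist_def r_def)
  then show ?thesis using u by blast
qed

lemma navigable_near_edges: "navigable {..<n} (hub_dist n) 1 (near_edges n)"
  unfolding navigable_def
proof (intro conjI ballI impI)
  show "near_edges n \<subseteq> {..<n} \<times> {..<n}" by (auto simp: near_edges_def)
next
  fix s t assume st: "s \<in> {..<n}" "t \<in> {..<n}" "0 < hub_dist n s t"
  have "\<exists>u<n. (s, u) \<in> near_edges n \<and> hub_dist n u t < hub_dist n s t"
  proof (cases "s div 3 = t div 3")
    case True
    moreover have "3 * (s div 3) + s mod 3 = s" "3 * (t div 3) + t mod 3 = t"
      "s mod 3 < 3" "t mod 3 < 3" by simp_all
    ultimately have "s \<le> t + 3" "t \<le> s + 3" by linarith+
    then have "(s, t) \<in> near_edges n" using st by (simp add: near_edges_def)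
    moreover have "hub_dist n t t < hub_dist n s t" using st by simp
    ultimately show ?thesis using st by blast
  next
    case False
    then show ?thesis
      using st hub_dist_step_along_line[of s n t] hub_dist_step_within_group[of s n t] by blast
  qed
  then show "\<exists>u\<in>{..<n}. (s, u) \<in> near_edges n \<and> hub_dist n u t < hub_dist n s t / 1"
    by auto
qed

lemma near_edges_degree: "card (near_edges n `` {x}) \<le> 7"
proof -
  have "near_edges n `` {x} \<subseteq> {x - 3..x + 3}" by (auto simp: near_edges_def)
  then have "card (near_edges n `` {x}) \<le> card {x - 3..x + 3}" by (rule card_mono[rotated]) simp
  then show ?thesis by simp
qed

lemma max_out_degree_near_edges:
  assumes "0 < n"
  shows "max_out_degree {..<n} (near_edges n) \<le> 7"
  unfolding max_out_degree_def using assms near_edges_degree by (subst Max_le_iff) auto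

lemma card_near_edges: "card (near_edges n) \<le> 7 * n"
proof -
  have "near_edges n = (SIGMA x:{..<n}. near_edges n `` {x})" by (auto simp: near_edges_def)
  moreover have "finite (near_edges n `` {x})" for x
    by (rule finite_subset[of _ "{..<n}"]) (auto simp: near_edges_def)
  ultimately have "card (near_edges n) = (\<Sum>x<n. card (near_edges n `` {x}))"
    by (metis card_SigmaI finite_lessThan)
  also have "\<dots> \<le> (\<Sum>x<n. 7)" by (intro sum_mono near_edges_degree)
  finally show ?thesis by simp
qed

section \<open>Edges forced on the greedy algorithm\<close>

text \<open>Only an element scanned before \<open>t\<close> can remove it, and sorting puts it no
  further from \<open>s\<close> than \<open>t\<close>. Allowing equality in the last hypothesis
  makes the result independent of tie-breaking.\<close>

lemma select_keeps_uncovered: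
  assumes "sorted_wrt (\<lambda>u v. d s u \<le> d s v) us" "t \<in> set us"
    and "\<And>u. u \<in> set us \<Longrightarrow> u \<noteq> t \<Longrightarrow> d s u \<le> d s t \<Longrightarrow> \<not> d u t < d s t / \<alpha>"
  shows "t \<in> set (select d \<alpha> s us)"
  using assms
proof (induction d \<alpha> s us rule: select.induct)
  case (2 d \<alpha> s u us)
  show ?case
  proof (cases "t = u")
    case False
    then have "t \<in> set (filter (\<lambda>t. \<not> d u t < d s t / \<alpha>) us)" using 2(2-) by auto
    then have "t \<in> set (select d \<alpha> s (filter (\<lambda>t. \<not> d u t < d s t / \<alpha>) us))"
      using 2(2-) by (intro 2(1)) (auto simp: sorted_wrt_filter)
    then show ?thesis by simp
  qed simp
qed simp

definition residue_class :: "nat \<Rightarrow> nat \<Rightarrow> nat set" where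
  "residue_class n r = {x. x < n \<and> x mod 3 = r}"

lemma finite_residue_class: "finite (residue_class n r)"
  by (simp add: residue_class_def)

lemma card_residue_class:
  assumes "r < 3"
  shows "n div 3 \<le> card (residue_class n r)"
proof -
  have "inj_on (\<lambda>i. 3 * i + r) {..<n div 3}" by (auto simp: inj_on_def)
  moreover have "(\<lambda>i. 3 * i + r) ` {..<n div 3} \<subseteq> residue_class n r"
    using assms by (auto simp: residue_class_def)
  ultimately show ?thesis
    using card_inj_on_le[of _ "{..<n div 3}" "residue_class n r"] finite_residue_class by fastforce
qed

lemma slow_diskann_source_target_edges:
  assumes "slow_diskann {..<n} (hub_dist n) 1 E"
  shows "residue_class n 1 \<times> residue_class n 2 \<subseteq> E"
proof clarify
  fix s t assume "s \<in> residue_class n 1" "t \<in> residue_class n 2"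
  then have st: "s < n" "t < n" "s mod 3 = 1" "t mod 3 = 2" by (auto simp: residue_class_def)
  then have ds: "hub_dist n s t = 6 * real n" by (auto simp: hub_dist_def)
  obtain ord where ord: "scan_order {..<n} (hub_dist n) s (ord s)"
    and E: "E = (SIGMA s:{..<n}. set (select (hub_dist n) 1 s (ord s)))"
    using assms st(1) unfolding slow_diskann_def by blast
  have set_ord: "set (ord s) = {..<n} - {s}" using ord by (simp add: scan_order_def)
  have "t \<in> set (select (hub_dist n) 1 s (ord s))"
  proof (rule select_keeps_uncovered)
    show "sorted_wrt (\<lambda>u v. hub_dist n s u \<le> hub_dist n s v) (ord s)"
      using ord by (simp add: scan_order_def)
    have "s \<noteq> t" using st by auto
    then show "t \<in> set (ord s)" using set_ord st(2) by simp
  next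
    fix u assume u: "u \<in> set (ord s)" "u \<noteq> t" "hub_dist n s u \<le> hub_dist n s t"
    have "s \<noteq> u" using u(1) set_ord by simp
    \<comment> \<open>Hubs are at least \<open>7 * n\<close> from \<open>s\<close>. What remains is
      at distance exactly \<open>6 * n\<close> from \<open>t\<close>, as is \<open>s\<close>, so the
      strict removal test fails.\<close>
    have "u mod 3 \<noteq> 0"
    proof
      assume "u mod 3 = 0"
      then have "hub_dist n s u = 7 * real n + index_gap s u"
        using \<open>s \<noteq> u\<close> st(3) by (simp add: hub_dist_def)
      then show False using u(3) ds st(1) index_gap_nonneg[of s u] by linarith
    qed
    then have "u mod 3 = 1 \<or> u mod 3 = 2" by presburger
    then have "hub_dist n u t = 6 * real n" using u(2) st by (auto simp: hub_dist_def)
    then show "\<not> hub_dist n u t < hub_dist n s t / 1" using ds by simp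
  qed
  then show "(s, t) \<in> E" using st E by simp
qed

lemma slow_diskann_lower_bounds:
  assumes "slow_diskann {..<n} (hub_dist n) 1 E" "3 \<le> n"
  shows "n div 3 \<le> max_out_degree {..<n} E" "(n div 3)\<^sup>2 \<le> card E"
proof -
  have sub: "residue_class n 1 \<times> residue_class n 2 \<subseteq> E"
    using slow_diskann_source_target_edges[OF assms(1)] .
  have "E \<subseteq> {..<n} \<times> {..<n}"
    using slow_diskann_navigable[OF Metric_space_hub_dist _ assms(1)] by (simp add: navigable_def)
  then have finE: "finite E" by (rule finite_subset) simp
  have "1 \<in> residue_class n 1" using assms(2) by (simp add: residue_class_def)
  then have "residue_class n 2 \<subseteq> E `` {1}" using sub by auto
  then have "card (residue_class n 2) \<le> card (E `` {1})"
    using finE by (intro card_mono) auto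
  also have "\<dots> \<le> max_out_degree {..<n} E"
    unfolding max_out_degree_def using assms(2) by (intro Max_ge) auto
  finally show "n div 3 \<le> max_out_degree {..<n} E"
    using card_residue_class[of 2 n] by simp
  have "(n div 3)\<^sup>2 \<le> card (residue_class n 1) * card (residue_class n 2)"
    unfolding power2_eq_square by (intro mult_le_mono card_residue_class) auto
  also have "\<dots> = card (residue_class n 1 \<times> residue_class n 2)"
    by (simp add: card_cartesian_product)
  also have "\<dots> \<le> card E" using finE sub by (intro card_mono)
  finally show "(n div 3)\<^sup>2 \<le> card E" .
qed

text \<open>Here \<open>a\<close> bounds the cost of the output from below and \<open>b\<close> the
  cost \<open>k\<close> of a competitor from above. The sign of \<open>c\<close> is not assumed; it
  follows from \<open>0 < a\<close>.\<close>

lemma factor_lower_bound: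
  fixes c k a b :: real
  assumes "a \<le> c * k" "0 < a" "0 \<le> k" "k \<le> b"
  shows "a / b \<le> c"
proof -
  have "0 < c * k" using assms by linarith
  then have "0 < c" "0 < k" using assms(3) by (auto simp: zero_less_mult_iff)
  then have "c * k \<le> c * b" using assms(4) by simp
  then show ?thesis using assms \<open>0 < k\<close> by (simp add: divide_le_eq)
qed

theorem theorem3p2:
  "\<exists>\<alpha>\<ge>1. \<exists>C>0. \<exists>N. \<forall>n\<ge>N.
     \<exists>(P :: nat set) (d :: nat \<Rightarrow> nat \<Rightarrow> real).
       Metric_space P d \<and> finite P \<and> card P = n \<and>
       (\<forall>E. slow_diskann P d \<alpha> E \<longrightarrow>
          (\<forall>c. approx_max_degree P d \<alpha> c E \<longrightarrow> c \<ge> C * (real n / ln (real n))) \<and>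
          (\<forall>c. approx_total_edges P d \<alpha> c E \<longrightarrow> c \<ge> C * (real n / ln (real n))))"
proof -
  \<comment> \<open>\<open>252 = 6 * 6 * 7\<close>: the edge count loses a factor \<open>6\<close>
    for sources and for targets, and \<open>7\<close> bounds the degree of the competitor. The
    degree objective gives the better \<open>1 / 42\<close>.\<close>
  have bounds: "c \<ge> 1 / 252 * (real n / ln (real n))"
    if n: "3 \<le> n" and E: "slow_diskann {..<n} (hub_dist n) 1 E"
      and c: "approx_max_degree {..<n} (hub_dist n) 1 c E \<or>
        approx_total_edges {..<n} (hub_dist n) 1 c E" for n E c
  proof -
    have "n \<le> 6 * (n div 3)" using n by presburger
    then have third: "real n / 6 \<le> real (n div 3)" by linarith
    \<comment> \<open>From \<open>3\<close> on the logarithm is at least \<open>1\<close>, so a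
      linear bound implies the claimed one.\<close>
    have "exp 1 \<le> real n" using exp_le n by linarith
    then have "1 \<le> ln (real n)" using n by (subst ln_ge_iff) auto
    then have "real n / ln (real n) \<le> real n" using n by (simp add: divide_le_eq)
    moreover from c have "real n / 252 \<le> c"
    proof
      assume "approx_max_degree {..<n} (hub_dist n) 1 c E"
      then have "real (max_out_degree {..<n} E)
          \<le> c * real (max_out_degree {..<n} (near_edges n))"
        using navigable_near_edges by (simp add: approx_max_degree_def)
      then have "real n / 6 \<le> c * real (max_out_degree {..<n} (near_edges n))"
        using third slow_diskann_lower_bounds(1)[OF E n] by linarith
      then have "real n / 6 / 7 \<le> c"
        using n max_out_degree_near_edges[of n] by (intro factor_lower_bound) auto
      then show ?thesis by simp
    next
      assume "approx_total_edges {..<n} (hub_dist n) 1 c E"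
      then have "real (card E) \<le> c * real (card (near_edges n))"
        using navigable_near_edges by (simp add: approx_total_edges_def)
      moreover have "(real n / 6)\<^sup>2 \<le> (real (n div 3))\<^sup>2"
        using third by (intro power_mono) auto
      moreover have "(real (n div 3))\<^sup>2 \<le> real (card E)"
        using slow_diskann_lower_bounds(2)[OF E n] by (metis of_nat_le_iff of_nat_power)
      ultimately have "(real n / 6)\<^sup>2 \<le> c * real (card (near_edges n))" by linarith
      moreover have "real (card (near_edges n)) \<le> 7 * real n"
        using card_near_edges[of n] by linarith
      ultimately have "(real n / 6)\<^sup>2 / (7 * real n) \<le> c"
        using n by (intro factor_lower_bound) auto
      then show ?thesis using n by (simp add: power2_eq_square)
    qed
    ultimately show ?thesis by linarith
  qed
  have "\<exists>(P :: nat set) d. Metric_space P d \<and> finite P \<and> card P = n \<and>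
       (\<forall>E. slow_diskann P d 1 E \<longrightarrow>
          (\<forall>c. approx_max_degree P d 1 c E \<longrightarrow> c \<ge> 1 / 252 * (real n / ln (real n))) \<and>
          (\<forall>c. approx_total_edges P d 1 c E \<longrightarrow> c \<ge> 1 / 252 * (real n / ln (real n))))"
    if "3 \<le> n" for n
    by (rule exI[of _ "{..<n}"], rule exI[of _ "hub_dist n"])
      (use bounds[OF that] Metric_space_hub_dist finite_lessThan card_lessThan in blast)
  then show ?thesis
    by - (rule exI[of _ 1], rule conjI, simp, rule exI[of _ "1 / 252"], rule conjI, simp, blast)
qed

end
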